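(* Let $q$ be a nonzero complex number with a fixed square root $q^{1/2}$, let $a,b$ be nonzero complex numbers, let $x$ be a complex number and let $n$ be a nonnegative integer. Assume that no zero factors appear in the denominators of the summand on the left-hand side below and that the denominators on the right-hand side are nonzero. Then $$ {}_5\phi_4\left[\begin{matrix} q^{-n},\ qx,\ a,\ b,\ q^{1/2-n}/(ab)\\ x,\ q^{1-n}/a,\ q^{1-n}/b,\ q^{1/2}ab\end{matrix}\,\Big|\,q;q\right] =\frac{q^{-n/2}-x}{1-x}\cdot\frac{(ab;q)_n}{(a;q)_n\,(b;q)_n}\cdot\frac{(a;q^{1/2})_n\,(b;q^{1/2})_n\,(-q^{1/2};q^{1/2})_n}{(ab;q^{1/2})_n}. $$
   Context: For complex $y,p$: $(y;p)_0=1$ and $(y;p)_n=\prod_{i=0}^{n-1}(1-yp^i)$ for $n\ge 1$ (used with $p=q$ and with $p=q^{1/2}$). Half-integer powers of $q$ are powers of the fixed square root $q^{1/2}$; in particular $q^{n/2}=(q^{1/2})^n$. The basic hypergeometric series is $${}_{1+r}\phi_s\left[\begin{matrix} a_0,a_1,\dots,a_r\\ b_1,\dots,b_s\end{matrix}\,\Big|\,q;z\right]=\sum_{k=0}^{\infty}\frac{(a_0;q)_k(a_1;q)_k\cdots(a_r;q)_k}{(q;q)_k(b_1;q)_k\cdots(b_s;q)_k}\,z^k,$$ where the parameters are such that no zero factors appear in the denominators of the summand. When $q^{-n}$ is an upper parameter, all terms with $k>n$ vanish, so the series is the finite sum over $0\le k\le n$. *)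

theory Defs
  imports Complex_Main
begin

definition qpoch :: "complex \<Rightarrow> complex \<Rightarrow> nat \<Rightarrow> complex" where
  "qpoch y p n = (\<Prod>i<n. 1 - y * p ^ i)"

definition phi_denom :: "complex list \<Rightarrow> complex \<Rightarrow> nat \<Rightarrow> complex" where
  "phi_denom bs q k = qpoch q q k * (\<Prod>b\<leftarrow>bs. qpoch b q k)"

text \<open>The summand carries no factor \<open>((-1)^k q^(k(k-1)/2))^(1+s-r)\<close> for a series with \<open>r\<close>
  upper and \<open>s\<close> lower parameters; that factor is 1 when \<open>r = s + 1\<close>.\<close>

definition basic_hypergeom :: "complex list \<Rightarrow> complex list \<Rightarrow> complex \<Rightarrow> complex \<Rightarrow> complex" where
  "basic_hypergeom as bs q z = (\<Sum>k. (\<Prod>a\<leftarrow>as. qpoch a q k) / phi_denom bs q k * z ^ k)"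

lemma qpoch_powi_eq_0:
  assumes "q \<noteq> 0" "n < k"
  shows "qpoch (q powi (- int n)) q k = 0"
proof -
  have "1 - q powi (- int n) * q ^ n = 0"
    using assms by (simp add: power_int_minus)
  then show ?thesis
    using assms unfolding qpoch_def by (auto intro!: prod_zero)
qed

text \<open>All summands beyond \<open>n\<close> vanish because the numerator does, whatever the value of the
  denominator (division by zero yields zero), so only denominators with \<open>k \<le> n\<close> matter.\<close>

lemma basic_hypergeom_terminating:
  assumes "q \<noteq> 0"
  shows "basic_hypergeom (q powi (- int n) # as) bs q z =
    (\<Sum>k\<le>n. (\<Prod>a\<leftarrow>q powi (- int n) # as. qpoch a q k) / phi_denom bs q k * z ^ k)"
  unfolding basic_hypergeom_def
  by (rule suminf_finite) (auto simp: qpoch_powi_eq_0[OF assms])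

end

theory Submission
  imports Defs
begin

text \<open>The factor \<open>(qx;q)_k / (x;q)_k = (1 - x q^k) / (1 - x)\<close> makes the series affine in \<open>x\<close>.
  Rewriting \<open>(q^(1-n)/A;q)_k\<close> in terms of \<open>(A;q)_n / (A;q)_(n-k)\<close> turns it into a constant times
  \<open>\<Sum>k\<le>n. (1 - x q^k) u_k u_(n-k) s^(-k)\<close> with \<open>u_k = (a;q)_k (b;q)_k / ((q;q)_k (s a b;q)_k)\<close>,
  and reversing the order of summation reduces both parts to \<open>\<Sum>k\<le>n. u_k u_(n-k) s^k\<close>.
  This is the coefficient sequence of the product of two \<open>2\<phi>1\<close> series in the q-analogue of Clausen's
  formula; symmetrised under \<open>k \<mapsto> n - k\<close> it satisfies a first-order recurrence in \<open>n\<close>, proved by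
  telescoping.\<close>

section \<open>Identities for q-shifted factorials\<close>

lemma qpoch_0 [simp]: "qpoch y p 0 = 1"
  by (simp add: qpoch_def)

lemma qpoch_Suc: "qpoch y p (Suc n) = qpoch y p n * (1 - y * p ^ n)"
  by (simp add: qpoch_def)

lemma qpoch_nonzero_mono:
  assumes "qpoch y p n \<noteq> 0" "k \<le> n"
  shows "qpoch y p k \<noteq> 0"
  using assms by (auto simp: qpoch_def)

lemma qpoch_mult_neg: "qpoch y p n * qpoch (- y) p n = qpoch (y ^ 2) (p ^ 2) n"
proof -
  have "(1 - y * p ^ i) * (1 - - y * p ^ i) = 1 - y ^ 2 * (p ^ 2) ^ i" for i
    by (simp add: power_mult [symmetric] algebra_simps power2_eq_square power_add mult_2)
  then show ?thesis
    by (simp add: qpoch_def prod.distrib [symmetric])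
qed

lemma qpoch_shift: "(1 - x) * qpoch (q * x) q k = (1 - x * q ^ k) * qpoch x q k"
proof (induction k)
  case (Suc k)
  have "(1 - x) * qpoch (q * x) q (Suc k)
      = ((1 - x) * qpoch (q * x) q k) * (1 - x * q ^ Suc k)"
    by (simp add: qpoch_Suc mult_ac)
  then show ?case
    by (simp add: Suc.IH qpoch_Suc mult_ac)
qed simp

text \<open>Multiplied by A, the factor 1 - q^(1-n+k)/A becomes -q^(1-n+k) (1 - A q^(n-1-k)), which
  supplies the factor that (A;q)_(n-k-1) lacks compared with (A;q)_(n-k). The product left on the
  right does not depend on A, so it cancels in quotients.\<close>

lemma qpoch_reverse:
  assumes "q \<noteq> 0" "A \<noteq> 0" "k \<le> n"
  shows "qpoch (q powi (1 - int n) / A) q k * qpoch A q (n - k) * A ^ k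
       = qpoch A q n * (\<Prod>i<k. - (q powi (1 - int n) * q ^ i))"
  using \<open>k \<le> n\<close>
proof (induction k)
  case 0
  then show ?case by simp
next
  case (Suc k)
  define m where "m = n - Suc k"
  have m: "n - k = Suc m" "n = k + m + 1" using Suc.prems by (auto simp: m_def)
  have inv: "q powi (1 - int n) * q ^ k * q ^ m = 1"
  proof -
    have "q powi (1 - int n) * q powi int k * q powi int m = 1"
      using \<open>q \<noteq> 0\<close> by (simp add: m(2) flip: power_int_add del: power_int_of_nat)
    then show ?thesis by (simp only: power_int_of_nat)
  qed
  let ?B = "q powi (1 - int n) / A"
  have eq: "(1 - ?B * q ^ k) * A
      = - (q powi (1 - int n) * q ^ k) * (1 - A * q ^ m)"
    using inv \<open>A \<noteq> 0\<close> by (simp add: field_simps)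
  have "qpoch ?B q (Suc k) * qpoch A q m * A ^ Suc k
      = (qpoch ?B q k * qpoch A q m * A ^ k) * ((1 - ?B * q ^ k) * A)"
    by (simp only: qpoch_Suc power_Suc mult_ac)
  also have "\<dots> = (qpoch ?B q k * qpoch A q (Suc m) * A ^ k) * - (q powi (1 - int n) * q ^ k)"
    unfolding eq by (simp only: qpoch_Suc mult_ac)
  also have "\<dots> = qpoch A q n * (\<Prod>i<Suc k. - (q powi (1 - int n) * q ^ i))"
    using Suc.IH Suc.prems by (simp add: m(1))
  finally show ?case by (simp add: m_def)
qed

section \<open>The Clausen-type convolution and its evaluation\<close>

definition clausen_coeff :: "complex \<Rightarrow> complex \<Rightarrow> complex \<Rightarrow> nat \<Rightarrow> complex" where
  "clausen_coeff s a b k =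
     qpoch a (s^2) k * qpoch b (s^2) k / (qpoch (s^2) (s^2) k * qpoch (s * a * b) (s^2) k)"

lemma clausen_coeff_0 [simp]: "clausen_coeff s a b 0 = 1"
  by (simp add: clausen_coeff_def)

lemma clausen_coeff_Suc:
  assumes "qpoch (s^2) (s^2) (Suc k) \<noteq> 0" "qpoch (s * a * b) (s^2) (Suc k) \<noteq> 0"
  shows "(1 - (s * s^k)^2) * (1 - s * a * b * (s^k)^2) * clausen_coeff s a b (Suc k)
       = (1 - a * (s^k)^2) * (1 - b * (s^k)^2) * clausen_coeff s a b k"
proof -
  have "(s^2) ^ k = (s^k)^2" by (simp add: power_mult [symmetric] mult.commute)
  then show ?thesis
    using assms unfolding clausen_coeff_def qpoch_Suc
    by (simp add: power_mult_distrib divide_simps)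
qed

text \<open>Telescoping certificate found by the q-Zeilberger method, with \<open>t = s^k\<close> and
  \<open>r = s^(n-k)\<close>. Without the symmetrising weights \<open>t + s r\<close> and \<open>t + r\<close> it would acquire the
  denominator \<open>1 + a b s^n\<close>, which may vanish.\<close>

lemma clausen_certificate:
  fixes s a b t r :: complex
  shows "(1 - s*a*b*t^2*r^2) * (1 - s*t*r) * (1 - a*b*t*r) * ((1 - a*r^2) * (1 - b*r^2)) * (t + s*r)
     - (1 - a*b*t^2*r^2) * (1 - a*t*r) * (1 - b*t*r) * (t + r) * ((1 - (s*r)^2) * (1 - s*a*b*r^2))
     = (1 - (s*r)^2) * (1 - s*a*b*r^2) * ((1 - a*t^2) * (1 - b*t^2)) * r * (a*b*t*r^3 - 1)
     - (1 - a*r^2) * (1 - b*r^2) * (1 - t^2) * (s - a*b*t^2) * r * (a*b*s^2*t*r^3 - 1)"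
  by algebra

lemma sum_reverse_atMost:
  fixes f :: "nat \<Rightarrow> nat \<Rightarrow> 'a::comm_monoid_add"
  shows "(\<Sum>k\<le>n. f k (n - k)) = (\<Sum>k\<le>n. f (n - k) k)"
  by (rule sum.reindex_bij_witness [where i = "\<lambda>k. n - k" and j = "\<lambda>k. n - k"]) auto

text \<open>The coefficient of z^n in F(z) F(s z), where F is the 2phi1 series with upper parameters
  a, b, lower parameter s a b and base s^2.\<close>

definition clausen_sum :: "complex \<Rightarrow> complex \<Rightarrow> complex \<Rightarrow> nat \<Rightarrow> complex" where
  "clausen_sum s a b n = (\<Sum>k\<le>n. clausen_coeff s a b k * clausen_coeff s a b (n - k) * s^k)"

lemma clausen_sum_reverse:
  "clausen_sum s a b n = (\<Sum>k\<le>n. clausen_coeff s a b k * clausen_coeff s a b (n - k) * s^(n - k))"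
  unfolding clausen_sum_def
  by (subst sum_reverse_atMost [where f = "\<lambda>k m. clausen_coeff s a b k * clausen_coeff s a b m * s^m"])
    (simp add: mult_ac)

lemma clausen_sum_Suc:
  fixes s a b :: complex and n :: nat
  assumes s: "s \<noteq> 0"
    and q: "qpoch (s^2) (s^2) (Suc n) \<noteq> 0" and c: "qpoch (s * a * b) (s^2) (Suc n) \<noteq> 0"
  shows "(1 - s*a*b*(s^n)^2) * (1 - s*s^n) * (1 - a*b*s^n) * clausen_sum s a b (Suc n)
       = (1 - a*b*(s^n)^2) * (1 - a*s^n) * (1 - b*s^n) * clausen_sum s a b n"
proof -
  define u where "u = clausen_coeff s a b"
  define D where "D = (1 - s*a*b*(s^n)^2) * (1 - s*s^n) * (1 - a*b*s^n)"
  define R where "R = (1 - a*b*(s^n)^2) * (1 - a*s^n) * (1 - b*s^n)"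
  \<comment> \<open>The two factors after the coefficients are the left-hand factors of
    \<open>u_Suc\<close> at k - 1. Hence \<open>u (Suc k)\<close> in \<open>G (Suc k)\<close> can be
    traded for \<open>u k\<close>, and \<open>G 0\<close> vanishes.\<close>
  define G where "G k = u k * u (Suc n - k) * (1 - (s^k)^2) * (1 - a*b*(s^k)^2/s)
      * s^(Suc n - k) * (a*b*s^k*(s^(Suc n - k))^3/s - 1)" for k
  have u_Suc: "(1 - (s * s^k)^2) * (1 - s*a*b*(s^k)^2) * u (Suc k)
       = (1 - a*(s^k)^2) * (1 - b*(s^k)^2) * u k"
    and nz: "(1 - (s * s^k)^2) * (1 - s*a*b*(s^k)^2) \<noteq> 0" if "k \<le> n" for k
  proof -
    have 1: "qpoch (s^2) (s^2) (Suc k) \<noteq> 0" "qpoch (s * a * b) (s^2) (Suc k) \<noteq> 0"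
      using that qpoch_nonzero_mono [OF q] qpoch_nonzero_mono [OF c] by auto
    show "(1 - (s * s^k)^2) * (1 - s*a*b*(s^k)^2) * u (Suc k)
       = (1 - a*(s^k)^2) * (1 - b*(s^k)^2) * u k"
      unfolding u_def using clausen_coeff_Suc [OF 1] .
    have "(s^2) ^ k = (s^k)^2" by (simp add: power_mult [symmetric] mult.commute)
    then show "(1 - (s * s^k)^2) * (1 - s*a*b*(s^k)^2) \<noteq> 0"
      using 1 by (auto simp: qpoch_Suc power_mult_distrib)
  qed
  have step: "D * (u k * u (Suc n - k) * (s^k + s^(Suc n - k)))
      - R * (u k * u (n - k) * (s^k + s^(n - k))) = G (Suc k) - G k" if "k \<le> n" for k
  proof -
    define t r where "t = s^k" and "r = s^(n - k)"
    have N: "s^n = t * r" using that by (simp add: t_def r_def flip: power_add)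
    have S: "Suc n - k = Suc (n - k)" using that by simp
    have sr: "s^(Suc n - k) = s * r" by (simp add: S r_def)
    define d where "d = (1 - (s*r)^2) * (1 - s*a*b*r^2)"
    have d: "d \<noteq> 0" using nz [of "n - k"] by (simp add: d_def r_def)
    have ur: "d * u (Suc n - k) = (1 - a*r^2) * (1 - b*r^2) * u (n - k)"
      using u_Suc [of "n - k"] by (simp add: d_def r_def S)
    have ut: "(1 - (s*t)^2) * (1 - s*a*b*t^2) * u (Suc k) = (1 - a*t^2) * (1 - b*t^2) * u k"
      using u_Suc [of k] that by (simp add: t_def)
    have "G (Suc k) = ((1 - (s*t)^2) * (1 - s*a*b*t^2) * u (Suc k)) * u (n - k) * r * (a*b*t*r^3 - 1)"
      using s by (simp add: G_def field_simps power2_eq_square flip: t_def r_def)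
    then have G1: "G (Suc k) = u k * u (n - k) * ((1 - a*t^2) * (1 - b*t^2) * r * (a*b*t*r^3 - 1))"
      by (simp add: ut)
    have G0: "G k = u k * u (Suc n - k) * ((1 - t^2) * (s - a*b*t^2) * r * (a*b*s^2*t*r^3 - 1))"
      unfolding G_def sr t_def [symmetric] using s
      by (simp add: field_simps power2_eq_square power3_eq_cube)
    \<comment> \<open>Multiplying by the nonzero \<open>d\<close> turns \<open>u (Suc n - k)\<close>
      into a multiple of \<open>u (n - k)\<close>. All terms then share the factor
      \<open>u k * u (n - k)\<close>, and what remains is the polynomial identity of the
      certificate.\<close>
    have "d * (D * (u k * u (Suc n - k) * (t + s*r)) - R * (u k * u (n - k) * (t + r)))
        = D * (u k * (d * u (Suc n - k)) * (t + s*r)) - d * (R * (u k * u (n - k) * (t + r)))"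
      by (simp add: algebra_simps)
    also have "\<dots> = u k * u (n - k) * (D * ((1 - a*r^2) * (1 - b*r^2)) * (t + s*r) - R * (t + r) * d)"
      unfolding ur by (simp add: algebra_simps)
    also have "D * ((1 - a*r^2) * (1 - b*r^2)) * (t + s*r) - R * (t + r) * d
        = d * ((1 - a*t^2) * (1 - b*t^2)) * r * (a*b*t*r^3 - 1)
        - (1 - a*r^2) * (1 - b*r^2) * (1 - t^2) * (s - a*b*t^2) * r * (a*b*s^2*t*r^3 - 1)"
      using clausen_certificate [of s a b t r] unfolding D_def R_def N d_def
      by (simp only: power_mult_distrib mult_ac)
    also have "u k * u (n - k) * \<dots> = d * G (Suc k)
        - u k * ((1 - a*r^2) * (1 - b*r^2) * u (n - k))
          * ((1 - t^2) * (s - a*b*t^2) * r * (a*b*s^2*t*r^3 - 1))"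
      unfolding G1 by algebra
    also have "\<dots> = d * (G (Suc k) - G k)"
      unfolding ur [symmetric] G0 by algebra
    finally show ?thesis
      using d by (simp add: sr flip: t_def r_def)
  qed
  have G_0: "G 0 = 0" by (simp add: G_def)
  \<comment> \<open>The sum for n + 1 has one more term than the sum for n. Since 1 - (s^(n+1))^2 =
    (1 - s^(n+1)) (1 + s^(n+1)), that term cancels the upper boundary value of the telescoping
    sum.\<close>
  have G_end: "D * (u (Suc n) * u 0 * (s^Suc n + 1)) = - G (Suc n)"
  proof -
    have "G (Suc n) = u (Suc n) * u 0 * (1 - (s*s^n)^2) * (1 - s*a*b*(s^n)^2) * (a*b*s^n - 1)"
      using s by (simp add: G_def field_simps power2_eq_square)
    then show ?thesis
      unfolding D_def by (simp add: algebra_simps power2_eq_square)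
  qed
  \<comment> \<open>Adding the sum to its reversal produces the symmetric weights required by
    \<open>step\<close>.\<close>
  have double: "2 * clausen_sum s a b m = (\<Sum>k\<le>m. u k * u (m - k) * (s^k + s^(m - k)))" for m
  proof -
    have "2 * clausen_sum s a b m
        = (\<Sum>k\<le>m. u k * u (m - k) * s^k) + (\<Sum>k\<le>m. u k * u (m - k) * s^(m - k))"
      unfolding u_def clausen_sum_reverse [symmetric] clausen_sum_def [symmetric] by simp
    then show ?thesis by (simp add: sum.distrib distrib_left)
  qed
  have "D * (2 * clausen_sum s a b (Suc n)) - R * (2 * clausen_sum s a b n)
      = (\<Sum>k\<le>n. D * (u k * u (Suc n - k) * (s^k + s^(Suc n - k)))
          - R * (u k * u (n - k) * (s^k + s^(n - k))))
        + D * (u (Suc n) * u 0 * (s^Suc n + 1))"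
    unfolding double by (simp add: sum_distrib_left sum_subtractf distrib_left)
  also have "\<dots> = (\<Sum>k\<le>n. G (Suc k) - G k) - G (Suc n)"
    unfolding G_end using step by simp
  also have "(\<Sum>k\<le>n. G (Suc k) - G k) = G (Suc n)"
    using sum_lessThan_telescope [of G "Suc n"] by (simp add: G_0 lessThan_Suc_atMost)
  finally have "D * clausen_sum s a b (Suc n) = R * clausen_sum s a b n"
    by simp
  then show ?thesis unfolding D_def R_def .
qed

text \<open>Iteration of \<open>clausen_sum_Suc\<close> from the value 1 at n = 0: its factors
  linear in s^n build up the factorials with base s, those in (s^n)^2 the factorials with base
  s^2.\<close>

lemma clausen_sum_closed_form:
  fixes s a b :: complex and n :: nat
  assumes "s \<noteq> 0" "qpoch (s^2) (s^2) n \<noteq> 0" "qpoch (s * a * b) (s^2) n \<noteq> 0" "qpoch (a * b) s n \<noteq> 0"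
  shows "clausen_sum s a b n * (qpoch s s n * qpoch (a * b) s n * qpoch (s * a * b) (s^2) n)
       = qpoch a s n * qpoch b s n * qpoch (a * b) (s^2) n"
  using assms
proof (induction n)
  case 0
  then show ?case by (simp add: clausen_sum_def)
next
  case (Suc n)
  have "qpoch y p n \<noteq> 0" if "qpoch y p (Suc n) \<noteq> 0" for y p
    using that by (simp add: qpoch_Suc)
  then have IH: "clausen_sum s a b n * (qpoch s s n * qpoch (a * b) s n * qpoch (s * a * b) (s^2) n)
       = qpoch a s n * qpoch b s n * qpoch (a * b) (s^2) n"
    using Suc by blast
  have sn: "(s^2) ^ n = (s^n)^2" by (simp add: power_mult [symmetric] mult.commute)
  let ?P = "qpoch s s n * qpoch (a * b) s n * qpoch (s * a * b) (s^2) n"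
  have "clausen_sum s a b (Suc n)
        * (qpoch s s (Suc n) * qpoch (a * b) s (Suc n) * qpoch (s * a * b) (s^2) (Suc n))
      = ((1 - s*a*b*(s^n)^2) * (1 - s*s^n) * (1 - a*b*s^n) * clausen_sum s a b (Suc n)) * ?P"
    by (simp only: qpoch_Suc sn mult_ac)
  also have "\<dots> = (1 - a*b*(s^n)^2) * (1 - a*s^n) * (1 - b*s^n) * (clausen_sum s a b n * ?P)"
    unfolding clausen_sum_Suc [OF Suc.prems(1-3)] by (simp only: mult.assoc)
  also have "\<dots> = qpoch a s (Suc n) * qpoch b s (Suc n) * qpoch (a * b) (s^2) (Suc n)"
    unfolding IH by (simp only: qpoch_Suc sn mult_ac)
  finally show ?case .
qed

section \<open>Reduction of the hypergeometric series to the convolution\<close>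

lemma clausen_sum_affine:
  assumes "s \<noteq> 0"
  shows "(\<Sum>k\<le>n. clausen_coeff s a b k * clausen_coeff s a b (n - k) * (1 - x * (s^2)^k) / s^k)
       = (s powi (- int n) - x) * clausen_sum s a b n"
proof -
  let ?u = "clausen_coeff s a b"
  \<comment> \<open>Here 1/s^k = s^(-n) s^(n-k), while (s^2)^k/s^k = s^k; the constant part thus
    yields the reversed form of the sum and the part with x the direct form.\<close>
  have "?u k * ?u (n - k) * (1 - x * (s^2)^k) / s^k
      = s powi (- int n) * (?u k * ?u (n - k) * s^(n - k)) - x * (?u k * ?u (n - k) * s^k)"
    if "k \<le> n" for k
  proof -
    have "s^n = s^k * s^(n - k)" using that by (simp flip: power_add)
    moreover have "(s^2)^k = s^k * s^k" by (simp add: power2_eq_square power_mult_distrib)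
    ultimately show ?thesis using assms by (simp add: power_int_minus field_simps)
  qed
  then have "(\<Sum>k\<le>n. ?u k * ?u (n - k) * (1 - x * (s^2)^k) / s^k)
      = s powi (- int n) * (\<Sum>k\<le>n. ?u k * ?u (n - k) * s^(n - k))
        - x * (\<Sum>k\<le>n. ?u k * ?u (n - k) * s^k)"
    by (simp add: sum_subtractf sum_distrib_left)
  then show ?thesis
    unfolding clausen_sum_reverse [symmetric] clausen_sum_def [symmetric]
    by (simp add: left_diff_distrib)
qed

text \<open>Two numerator and two denominator factorials are reversed, so the common product
  \<open>w\<close> cancels. The powers A^k from the reversals, combined with the argument q^k, leave
  1/s^k.\<close>

lemma well_poised_term:
  fixes q s a b x :: complex
  assumes q: "q = s^2" and s: "s \<noteq> 0" and ab: "a \<noteq> 0" "b \<noteq> 0" and x: "1 - x \<noteq> 0" and k: "k \<le> n"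
    and den: "qpoch q q n \<noteq> 0" "qpoch (s*a*b) q n \<noteq> 0" "qpoch a q n \<noteq> 0" "qpoch b q n \<noteq> 0"
    and xk: "qpoch x q k \<noteq> 0"
  shows "(\<Prod>y\<leftarrow>[q powi (- int n), q * x, a, b, s powi (1 - 2 * int n) / (a * b)]. qpoch y q k)
       / phi_denom [x, q powi (1 - int n) / a, q powi (1 - int n) / b, s * a * b] q k * q^k
     = qpoch q q n * qpoch (s*a*b) q n / (qpoch a q n * qpoch b q n * (1 - x))
       * (clausen_coeff s a b k * clausen_coeff s a b (n - k) * (1 - x * (s^2)^k) / s^k)"
proof -
  have q0: "q \<noteq> 0" using q s by simp
  define w where "w = (\<Prod>i<k. - (q powi (1 - int n) * q ^ i))"
  have w: "w \<noteq> 0" using q0 by (simp add: w_def)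
  have rev: "qpoch (q powi (1 - int n) / A) q k = qpoch A q n * w / (qpoch A q (n - k) * A^k)"
    if "A \<noteq> 0" "qpoch A q n \<noteq> 0" for A
    using qpoch_reverse [OF q0 that(1) k] that qpoch_nonzero_mono [OF that(2), of "n - k"]
    by (simp add: w_def field_simps)
  \<comment> \<open>Both numerator parameters take the form q^(1-n)/A expected by
    \<open>rev\<close>, with A = q here and A = s a b in \<open>e2\<close>.\<close>
  have e1: "q powi (- int n) = q powi (1 - int n) / q"
    using q0 by (simp add: power_int_diff power_int_minus field_simps)
  have e2: "s powi (1 - 2 * int n) / (a * b) = q powi (1 - int n) / (s * a * b)"
  proof -
    have "s powi (1 - 2 * int n) * s = q powi (1 - int n)"
      using s by (simp add: q power_int_diff power_int_mult power2_eq_square)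
    then show ?thesis using s ab by (simp add: field_simps)
  qed
  have shift: "qpoch (q * x) q k = (1 - x * q^k) * qpoch x q k / (1 - x)"
    using qpoch_shift [of x q k] x by (simp add: field_simps)
  have nz: "qpoch q q j \<noteq> 0" "qpoch (s*a*b) q j \<noteq> 0" "qpoch a q j \<noteq> 0" "qpoch b q j \<noteq> 0"
    if "j \<le> n" for j using den that qpoch_nonzero_mono by blast+
  note nzk = nz [OF k] nz [of "n - k", simplified]
  have "s * a * b \<noteq> 0" using s ab by simp
  note revs = rev [OF q0 den(1)] rev [OF this den(2)] rev [OF ab(1) den(3)] rev [OF ab(2) den(4)]
  show ?thesis
    unfolding e1 e2 phi_denom_def clausen_coeff_def q [symmetric]
    using nzk den xk x w s ab q0
    by (simp add: revs shift divide_simps power_mult_distrib)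
qed

theorem theorem2:
  fixes q s a b x :: complex and n :: nat
  assumes "q \<noteq> 0" and "s ^ 2 = q" and "a \<noteq> 0" and "b \<noteq> 0"
    and "\<forall>k\<le>n. phi_denom
           [x, q powi (1 - int n) / a, q powi (1 - int n) / b, s * a * b] q k \<noteq> 0"
    and "1 - x \<noteq> 0" and "qpoch a q n * qpoch b q n \<noteq> 0" and "qpoch (a * b) s n \<noteq> 0"
  shows "basic_hypergeom
           [q powi (- int n), q * x, a, b, s powi (1 - 2 * int n) / (a * b)]
           [x, q powi (1 - int n) / a, q powi (1 - int n) / b, s * a * b] q q
       = (s powi (- int n) - x) / (1 - x)
         * (qpoch (a * b) q n / (qpoch a q n * qpoch b q n))
         * (qpoch a s n * qpoch b s n * qpoch (- s) s n / qpoch (a * b) s n)"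
proof -
  have s: "s \<noteq> 0" using assms(1,2) by auto
  have den: "qpoch q q n \<noteq> 0" "qpoch (s*a*b) q n \<noteq> 0" "qpoch a q n \<noteq> 0" "qpoch b q n \<noteq> 0"
    and xk: "\<And>k. k \<le> n \<Longrightarrow> qpoch x q k \<noteq> 0"
    using assms(5,7) by (auto simp: phi_denom_def)
  define C where "C = qpoch q q n * qpoch (s*a*b) q n / (qpoch a q n * qpoch b q n * (1 - x))"
  have "basic_hypergeom
           [q powi (- int n), q * x, a, b, s powi (1 - 2 * int n) / (a * b)]
           [x, q powi (1 - int n) / a, q powi (1 - int n) / b, s * a * b] q q
      = (\<Sum>k\<le>n. C * (clausen_coeff s a b k * clausen_coeff s a b (n - k) * (1 - x * (s^2)^k) / s^k))"
    unfolding basic_hypergeom_terminating [OF assms(1)] C_def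
    using well_poised_term [OF assms(2) [symmetric] s assms(3,4,6) _ den xk]
    by (intro sum.cong) auto
  also have "\<dots> = C * ((s powi (- int n) - x) * clausen_sum s a b n)"
    unfolding sum_distrib_left [symmetric] clausen_sum_affine [OF s] ..
  also have "\<dots> = (s powi (- int n) - x) / (1 - x)
         * (qpoch (a * b) q n / (qpoch a q n * qpoch b q n))
         * (qpoch a s n * qpoch b s n * qpoch (- s) s n / qpoch (a * b) s n)"
  proof -
    \<comment> \<open>The factor \<open>qpoch s s n\<close> cancels against the closed form of
      \<open>clausen_sum\<close>; \<open>qpoch (- s) s n\<close> survives on the right-hand
      side.\<close>
    have qq: "qpoch q q n = qpoch s s n * qpoch (- s) s n"
      using qpoch_mult_neg [of s s n] assms(2) by simp
    then have "qpoch s s n \<noteq> 0" using den(1) by auto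
    moreover have "clausen_sum s a b n * (qpoch s s n * qpoch (a * b) s n * qpoch (s*a*b) q n)
       = qpoch a s n * qpoch b s n * qpoch (a * b) q n"
      using clausen_sum_closed_form [OF s, of n a b] den assms(2,8) by simp
    ultimately have "clausen_sum s a b n = qpoch a s n * qpoch b s n * qpoch (a * b) q n
        / (qpoch s s n * qpoch (a * b) s n * qpoch (s*a*b) q n)"
      using den(2) assms(8) by (simp add: eq_divide_eq)
    then show ?thesis
      unfolding C_def qq using \<open>qpoch s s n \<noteq> 0\<close> den(2) by (simp add: mult_ac)
  qed
  finally show ?thesis .
qed

end
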